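(* Let $a,b\in\mathbb{R}$ with $b-a$ a positive integer, let $\alpha\in(0,1/2)$, and let $p,q,r$ be real-valued functions on $\mathbb{N}_{a,b}$ with $p(t)>0$ and $r(t)>0$ for all $t\in\mathbb{N}_{a,b}$. Consider the nabla discrete fractional Sturm--Liouville equation $${}^{ABR}_{a}\nabla^\alpha\big(p(t)\,{}^{ABR}\nabla^\alpha_b x(t)\big)+q(t)x(t)=\lambda r(t)x(t),\qquad t\in\mathbb{N}_{a+1,b-1}.$$ Eigenfunctions corresponding to distinct eigenvalues of this equation are orthogonal with respect to the weight function $r$: if $\lambda_1\ne\lambda_2$ are eigenvalues with corresponding eigenfunctions $x_{\lambda_1},x_{\lambda_2}$, then $$\sum_{t=a+1}^{b-1}r(t)\,x_{\lambda_1}(t)\,x_{\lambda_2}(t)=0.$$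
   Context: Notation: $\mathbb{N}_{c,d}=\{c,c+1,\dots,d\}$ (empty if $d<c$); $\rho(t)=t-1$; $\nabla f(t)=f(t)-f(t-1)$, $\Delta f(t)=f(t+1)-f(t)$; empty sums are $0$. The rising function is $t^{\overline{\gamma}}=\Gamma(t+\gamma)/\Gamma(t)$. For $|\lambda|<1$ the nabla discrete Mittag-Leffler function is $E_{\overline{\alpha}}(\lambda,z)=\sum_{k=0}^\infty\lambda^k\frac{z^{\overline{k\alpha}}}{\Gamma(\alpha k+1)}$ (here used only for positive integers $z$). $B(\alpha)>0$ is a normalization constant. The left and right nabla discrete ABR fractional differences of order $\alpha\in(0,1/2)$ are $${}^{ABR}_{a}\nabla^\alpha f(t)=\frac{B(\alpha)}{1-\alpha}\nabla_t\sum_{s=a+1}^t f(s)E_{\overline{\alpha}}\Big(\tfrac{-\alpha}{1-\alpha},t-\rho(s)\Big),\quad t\in\{a+1,a+2,\dots\},$$ $${}^{ABR}\nabla_b^\alpha f(t)=-\frac{B(\alpha)}{1-\alpha}\Delta_t\sum_{s=t}^{b-1} f(s)E_{\overline{\alpha}}\Big(\tfrac{-\alpha}{1-\alpha},s-\rho(t)\Big),\quad t\in\{\dots,b-2,b-1\}.$$ An eigenvalue is a $\lambda\in\mathbb{C}$ for which the equation has a nontrivial solution $x:\mathbb{N}_{a,b}\to\mathbb{C}$, called an eigenfunction corresponding to $\lambda$; nontrivial means not identically zero on $\mathbb{N}_{a+1,b-1}$ (the equation involves only the values of $x$ on $\mathbb{N}_{a+1,b-1}$). *)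

theory Defs
  imports "HOL-Analysis.Analysis"
begin

text \<open>Functions on discrete intervals are rendered as total functions on the reals; the
  definitions below, where used, only refer to values at points of the interval.\<close>

definition disc_ival :: "real \<Rightarrow> real \<Rightarrow> real set" where
  "disc_ival c d = {c + real k |k. c + real k \<le> d}"

definition rho :: "real \<Rightarrow> real" where
  "rho t = t - 1"

definition nabla_op :: "(real \<Rightarrow> complex) \<Rightarrow> real \<Rightarrow> complex" where
  "nabla_op f t = f t - f (t - 1)"

definition delta_op :: "(real \<Rightarrow> complex) \<Rightarrow> real \<Rightarrow> complex" where
  "delta_op f t = f (t + 1) - f t"

definition rising :: "real \<Rightarrow> real \<Rightarrow> real" where
  "rising t \<gamma> = Gamma (t + \<gamma>) / Gamma t"

text \<open>The nabla discrete Mittag-Leffler function; the series is meaningful for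
  \<open>\<bar>l\<bar> < 1\<close> and is only used at positive integers \<open>z\<close>, where it then converges.\<close>

definition nabla_ML :: "real \<Rightarrow> real \<Rightarrow> real \<Rightarrow> real" where
  "nabla_ML \<alpha> l z = (\<Sum>k. l ^ k * rising z (real k * \<alpha>) / Gamma (\<alpha> * real k + 1))"

definition ABR_left ::
  "(real \<Rightarrow> real) \<Rightarrow> real \<Rightarrow> real \<Rightarrow> (real \<Rightarrow> complex) \<Rightarrow> real \<Rightarrow> complex" where
  "ABR_left B a \<alpha> f t =
     complex_of_real (B \<alpha> / (1 - \<alpha>)) *
     nabla_op (\<lambda>u. \<Sum>s\<in>disc_ival (a + 1) u.
                   f s * complex_of_real (nabla_ML \<alpha> (- \<alpha> / (1 - \<alpha>)) (u - rho s))) t"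

definition ABR_right ::
  "(real \<Rightarrow> real) \<Rightarrow> real \<Rightarrow> real \<Rightarrow> (real \<Rightarrow> complex) \<Rightarrow> real \<Rightarrow> complex" where
  "ABR_right B b \<alpha> f t =
     - complex_of_real (B \<alpha> / (1 - \<alpha>)) *
     delta_op (\<lambda>u. \<Sum>s\<in>disc_ival u (b - 1).
                   f s * complex_of_real (nabla_ML \<alpha> (- \<alpha> / (1 - \<alpha>)) (s - rho u))) t"

definition SL_solution ::
  "(real \<Rightarrow> real) \<Rightarrow> real \<Rightarrow> real \<Rightarrow> real \<Rightarrow> (real \<Rightarrow> real) \<Rightarrow> (real \<Rightarrow> real) \<Rightarrow> (real \<Rightarrow> real)
    \<Rightarrow> complex \<Rightarrow> (real \<Rightarrow> complex) \<Rightarrow> bool" where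
  "SL_solution B a b \<alpha> p q r l x \<longleftrightarrow>
     (\<forall>t\<in>disc_ival (a + 1) (b - 1).
        ABR_left B a \<alpha> (\<lambda>s. complex_of_real (p s) * ABR_right B b \<alpha> x s) t
          + complex_of_real (q t) * x t
        = l * complex_of_real (r t) * x t)"

definition SL_eigenfunction ::
  "(real \<Rightarrow> real) \<Rightarrow> real \<Rightarrow> real \<Rightarrow> real \<Rightarrow> (real \<Rightarrow> real) \<Rightarrow> (real \<Rightarrow> real) \<Rightarrow> (real \<Rightarrow> real)
    \<Rightarrow> complex \<Rightarrow> (real \<Rightarrow> complex) \<Rightarrow> bool" where
  "SL_eigenfunction B a b \<alpha> p q r l x \<longleftrightarrow>
     SL_solution B a b \<alpha> p q r l x \<and> (\<exists>t\<in>disc_ival (a + 1) (b - 1). x t \<noteq> 0)"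

definition SL_eigenvalue ::
  "(real \<Rightarrow> real) \<Rightarrow> real \<Rightarrow> real \<Rightarrow> real \<Rightarrow> (real \<Rightarrow> real) \<Rightarrow> (real \<Rightarrow> real) \<Rightarrow> (real \<Rightarrow> real)
    \<Rightarrow> complex \<Rightarrow> bool" where
  "SL_eigenvalue B a b \<alpha> p q r l \<longleftrightarrow> (\<exists>x. SL_eigenfunction B a b \<alpha> p q r l x)"

end

theory Submission
  imports Defs
begin

text \<open>On \<open>\<nat>\<^bsub>a+1,b-1\<^esub>\<close> the left and right differences are given by a triangular convolution
  matrix and its transpose, whatever the values of the Mittag-Leffler function. The operator of the
  equation therefore has the form \<open>M P M\<^sup>T + Q\<close> with diagonal \<open>P\<close> and \<open>Q\<close>, so it is symmetric
  for the bilinear form \<open>\<Sum>t. f t * g t\<close>. Pairing the two equations with each other's solution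
  and subtracting gives \<open>(l1 - l2) * (\<Sum>t. r t * x1 t * x2 t) = 0\<close>.\<close>

lemma disc_ivalI: "s = c + real k \<Longrightarrow> s \<le> d \<Longrightarrow> s \<in> disc_ival c d"
  by (auto simp: disc_ival_def)

lemma finite_disc_ival: "finite (disc_ival c d)"
proof -
  have "disc_ival c d \<subseteq> (\<lambda>k. c + real k) ` {..nat \<lfloor>d - c\<rfloor>}"
    by (auto simp: disc_ival_def le_nat_floor)
  then show ?thesis
    using finite_surj by blast
qed

text \<open>The four cut lemmas rewrite ranges with a moving endpoint as filters of one fixed finite
  set, so that all sums can be merged over a common index set.\<close>

lemma disc_ival_cut_le:
  assumes "t \<in> disc_ival c d"
  shows "disc_ival c t = {s \<in> disc_ival c d. s \<le> t}"
  using assms by (auto simp: disc_ival_def)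

text \<open>Both \<open>s\<close> and \<open>t\<close> lie on the lattice of step 1 starting at
  \<open>c\<close>, so \<open>s \<le> t - 1\<close> and \<open>s < t\<close> coincide; for
  \<open>t = c\<close> both sides are empty.\<close>

lemma disc_ival_cut_less:
  assumes "t \<in> disc_ival c d"
  shows "disc_ival c (t - 1) = {s \<in> disc_ival c d. s < t}"
  using assms by (auto simp: disc_ival_def)

text \<open>Here the base point moves from \<open>c\<close> to \<open>t\<close>; as \<open>t\<close>
  is itself a lattice point, a shift of the index by \<open>j\<close> relates the two
  lattices.\<close>

lemma disc_ival_cut_ge:
  assumes "t \<in> disc_ival c d"
  shows "disc_ival t d = {s \<in> disc_ival c d. t \<le> s}"
proof -
  obtain j where t: "t = c + real j"
    using assms by (auto simp: disc_ival_def)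
  show ?thesis
  proof (intro equalityI subsetI)
    fix s assume "s \<in> disc_ival t d"
    then obtain k where k: "s = c + real (j + k)" "s \<le> d"
      by (auto simp: disc_ival_def t)
    then have "s \<in> disc_ival c d"
      by (rule disc_ivalI)
    with k show "s \<in> {s \<in> disc_ival c d. t \<le> s}"
      by (simp add: t)
  next
    fix s assume "s \<in> {s \<in> disc_ival c d. t \<le> s}"
    then obtain k where "s = c + real k" "s \<le> d" "j \<le> k"
      by (auto simp: disc_ival_def t)
    then have "s = t + real (k - j)" "s \<le> d"
      by (auto simp: t of_nat_diff)
    then show "s \<in> disc_ival t d"
      by (auto simp: disc_ival_def)
  qed
qed

lemma disc_ival_cut_greater:
  assumes "t \<in> disc_ival c d"
  shows "disc_ival (t + 1) d = {s \<in> disc_ival c d. t < s}"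
proof -
  have "disc_ival (t + 1) d = {s \<in> disc_ival t d. t < s}"
  proof (intro equalityI subsetI)
    fix s assume "s \<in> disc_ival (t + 1) d"
    then obtain k where k: "s = t + real (Suc k)" "s \<le> d"
      by (auto simp: disc_ival_def)
    then have "s \<in> disc_ival t d"
      by (rule disc_ivalI)
    with k show "s \<in> {s \<in> disc_ival t d. t < s}"
      by simp
  next
    fix s assume "s \<in> {s \<in> disc_ival t d. t < s}"
    then obtain k where k: "s = t + real k" "s \<le> d" "0 < k"
      by (auto simp: disc_ival_def)
    then have "s = t + 1 + real (k - 1)"
      by (auto simp: of_nat_diff)
    then show "s \<in> disc_ival (t + 1) d"
      using \<open>s \<le> d\<close>
      by (rule disc_ivalI)
  qed
  then show ?thesis
    using disc_ival_cut_ge[OF assms] by auto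
qed

text \<open>The matrix entry at offset \<open>d\<close>. The two conditions record the ranges of the
  two sums in the difference: at \<open>d = 0\<close> only the first contributes, and for
  \<open>d < 0\<close> the entry vanishes, which makes the matrix triangular.\<close>

definition ABR_kernel :: "(real \<Rightarrow> real) \<Rightarrow> real \<Rightarrow> real \<Rightarrow> complex" where
  "ABR_kernel B \<alpha> d = complex_of_real (B \<alpha> / (1 - \<alpha>)) *
     ((if 0 \<le> d then complex_of_real (nabla_ML \<alpha> (- \<alpha> / (1 - \<alpha>)) (d + 1)) else 0)
      - (if 0 < d then complex_of_real (nabla_ML \<alpha> (- \<alpha> / (1 - \<alpha>)) d) else 0))"

text \<open>Since \<open>rho s = s - 1\<close>, the sum up to \<open>t\<close> carries the argument
  \<open>t - s + 1\<close> and the sum up to \<open>t - 1\<close> carries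
  \<open>t - s\<close>.\<close>

lemma ABR_left_eq_kernel_sum:
  assumes t: "t \<in> disc_ival (a + 1) d"
  shows "ABR_left B a \<alpha> f t = (\<Sum>s\<in>disc_ival (a + 1) d. ABR_kernel B \<alpha> (t - s) * f s)"
proof -
  define E where "E = (\<lambda>z. complex_of_real (nabla_ML \<alpha> (- \<alpha> / (1 - \<alpha>)) z))"
  define S where "S = disc_ival (a + 1) d"
  have fin: "finite S"
    by (simp add: S_def finite_disc_ival)
  have "ABR_left B a \<alpha> f t = complex_of_real (B \<alpha> / (1 - \<alpha>)) *
      ((\<Sum>s | s \<in> S \<and> s \<le> t. f s * E (t - s + 1)) - (\<Sum>s | s \<in> S \<and> s < t. f s * E (t - s)))"
    unfolding ABR_left_def nabla_op_def disc_ival_cut_le[OF t] disc_ival_cut_less[OF t]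
    by (simp add: E_def S_def rho_def algebra_simps)
  also have "\<dots> = complex_of_real (B \<alpha> / (1 - \<alpha>)) *
      (\<Sum>s\<in>S. (if s \<le> t then f s * E (t - s + 1) else 0) - (if s < t then f s * E (t - s) else 0))"
    \<comment> \<open>Each filtered sum becomes a sum over all of \<open>S\<close> padded with
      zeros, so the difference can be taken termwise.\<close>
    using fin by (simp only: sum_subtractf sum.inter_filter)
  also have "\<dots> = (\<Sum>s\<in>S. ABR_kernel B \<alpha> (t - s) * f s)"
    unfolding sum_distrib_left by (intro sum.cong) (auto simp: ABR_kernel_def E_def algebra_simps)
  finally show ?thesis
    by (simp add: S_def)
qed

text \<open>The leading minus sign turns the forward difference into the sum from \<open>t\<close>
  minus the sum from \<open>t + 1\<close>, with arguments \<open>s - t + 1\<close> and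
  \<open>s - t\<close>: the same kernel, transposed.\<close>

lemma ABR_right_eq_kernel_sum:
  assumes t: "t \<in> disc_ival c (b - 1)"
  shows "ABR_right B b \<alpha> f t = (\<Sum>s\<in>disc_ival c (b - 1). ABR_kernel B \<alpha> (s - t) * f s)"
proof -
  define E where "E = (\<lambda>z. complex_of_real (nabla_ML \<alpha> (- \<alpha> / (1 - \<alpha>)) z))"
  define S where "S = disc_ival c (b - 1)"
  have fin: "finite S"
    by (simp add: S_def finite_disc_ival)
  have "ABR_right B b \<alpha> f t = complex_of_real (B \<alpha> / (1 - \<alpha>)) *
      ((\<Sum>s | s \<in> S \<and> t \<le> s. f s * E (s - t + 1)) - (\<Sum>s | s \<in> S \<and> t < s. f s * E (s - t)))"
    unfolding ABR_right_def delta_op_def disc_ival_cut_ge[OF t] disc_ival_cut_greater[OF t]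
    by (simp add: E_def S_def rho_def algebra_simps)
  also have "\<dots> = complex_of_real (B \<alpha> / (1 - \<alpha>)) *
      (\<Sum>s\<in>S. (if t \<le> s then f s * E (s - t + 1) else 0) - (if t < s then f s * E (s - t) else 0))"
    using fin by (simp only: sum_subtractf sum.inter_filter)
  also have "\<dots> = (\<Sum>s\<in>S. ABR_kernel B \<alpha> (s - t) * f s)"
    unfolding sum_distrib_left by (intro sum.cong) (auto simp: ABR_kernel_def E_def algebra_simps)
  finally show ?thesis
    by (simp add: S_def)
qed

text \<open>Exchanging the order of the double sum transposes the kernel; no boundary terms
  arise.\<close>

lemma ABR_summation_by_parts:
  "(\<Sum>t\<in>disc_ival (a + 1) (b - 1). g t * ABR_left B a \<alpha> f t)
     = (\<Sum>t\<in>disc_ival (a + 1) (b - 1). f t * ABR_right B b \<alpha> g t)"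
proof -
  let ?T = "disc_ival (a + 1) (b - 1)"
  have "(\<Sum>t\<in>?T. g t * ABR_left B a \<alpha> f t)
      = (\<Sum>t\<in>?T. \<Sum>s\<in>?T. g t * (ABR_kernel B \<alpha> (t - s) * f s))"
    by (simp add: ABR_left_eq_kernel_sum sum_distrib_left)
  also have "\<dots> = (\<Sum>s\<in>?T. \<Sum>t\<in>?T. f s * (ABR_kernel B \<alpha> (t - s) * g t))"
    by (subst sum.swap) (simp add: algebra_simps)
  also have "\<dots> = (\<Sum>s\<in>?T. f s * ABR_right B b \<alpha> g s)"
    by (simp add: ABR_right_eq_kernel_sum sum_distrib_left)
  finally show ?thesis .
qed

text \<open>Multiply the equation by \<open>y t\<close>, sum, and move the left difference onto
  \<open>y\<close>. The resulting right-hand side is symmetric in \<open>x\<close> and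
  \<open>y\<close>.\<close>

lemma SL_solution_pairing:
  assumes "SL_solution B a b \<alpha> p q r l x"
  shows "l * (\<Sum>t\<in>disc_ival (a + 1) (b - 1). complex_of_real (r t) * x t * y t)
    = (\<Sum>t\<in>disc_ival (a + 1) (b - 1).
         complex_of_real (p t) * ABR_right B b \<alpha> x t * ABR_right B b \<alpha> y t)
      + (\<Sum>t\<in>disc_ival (a + 1) (b - 1). complex_of_real (q t) * x t * y t)"
proof -
  let ?T = "disc_ival (a + 1) (b - 1)"
  let ?f = "\<lambda>s. complex_of_real (p s) * ABR_right B b \<alpha> x s"
  have "l * (\<Sum>t\<in>?T. complex_of_real (r t) * x t * y t)
      = (\<Sum>t\<in>?T. y t * (l * complex_of_real (r t) * x t))"
    by (simp add: sum_distrib_left mult_ac)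
  also have "\<dots> = (\<Sum>t\<in>?T. y t * (ABR_left B a \<alpha> ?f t + complex_of_real (q t) * x t))"
    using assms by (intro sum.cong) (simp_all add: SL_solution_def)
  also have "\<dots> = (\<Sum>t\<in>?T. y t * ABR_left B a \<alpha> ?f t)
      + (\<Sum>t\<in>?T. complex_of_real (q t) * x t * y t)"
    by (simp add: distrib_left sum.distrib mult_ac)
  finally show ?thesis
    by (simp add: ABR_summation_by_parts)
qed

theorem theorem10:
  fixes a b \<alpha> :: real
    and B p q r :: "real \<Rightarrow> real"
    and l1 l2 :: complex
    and x1 x2 :: "real \<Rightarrow> complex"
  assumes "b - a \<in> \<nat>" and "b - a > 0"
    and "0 < \<alpha>" and "\<alpha> < 1 / 2"
    and "B \<alpha> > 0"
    and "\<And>t. t \<in> disc_ival a b \<Longrightarrow> p t > 0"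
    and "\<And>t. t \<in> disc_ival a b \<Longrightarrow> r t > 0"
    and "SL_eigenvalue B a b \<alpha> p q r l1" and "SL_eigenvalue B a b \<alpha> p q r l2"
    and "l1 \<noteq> l2"
    and "SL_eigenfunction B a b \<alpha> p q r l1 x1"
    and "SL_eigenfunction B a b \<alpha> p q r l2 x2"
  shows "(\<Sum>t\<in>disc_ival (a + 1) (b - 1). complex_of_real (r t) * x1 t * x2 t) = 0"
proof -
  have "SL_solution B a b \<alpha> p q r l1 x1" "SL_solution B a b \<alpha> p q r l2 x2"
    using assms by (auto simp: SL_eigenfunction_def)
  \<comment> \<open>Each solution is tested against the other; by symmetry the two right-hand sides
    agree.\<close>
  from this(1)[THEN SL_solution_pairing, of x2] this(2)[THEN SL_solution_pairing, of x1]
  have "l1 * (\<Sum>t\<in>disc_ival (a + 1) (b - 1). complex_of_real (r t) * x1 t * x2 t)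
      = l2 * (\<Sum>t\<in>disc_ival (a + 1) (b - 1). complex_of_real (r t) * x1 t * x2 t)"
    by (simp add: mult_ac)
  with \<open>l1 \<noteq> l2\<close> show ?thesis
    by simp
qed

end
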